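(* Let $f:\mathbb{S}^1\to\mathbb{S}^1$ be a $C^2$ expanding circle map and let $\omega\ge 0$. Then for every $z\in\mathbb{S}^1$, $$\overline h_{\omega}(z)=\max\left\{\left(1-\frac{\omega}{\overline\lambda(z)}\right)h_{\mathrm{top}}(f),\ 0\right\},$$ where $\overline\lambda(z)=\limsup_{n\to\infty}\frac1n\log|Df^n(z)|$ is the upper Lyapunov exponent of $z$, and $$\underline h_{\omega}(z)=\max\left\{\left(1-\frac{\omega}{\underline\lambda(z)}\right)h_{\mathrm{top}}(f),\ 0\right\},$$ where $\underline\lambda(z)=\liminf_{n\to\infty}\frac1n\log|Df^n(z)|$ is the lower Lyapunov exponent of $z$.
   Context: $\mathbb{S}^1=\mathbb{R}/\mathbb{Z}$ with its usual metric. A $C^2$ map $f:\mathbb S^1\to\mathbb S^1$ is expanding if there is $c>1$ with $|f'(x)|\ge c$ for all $x\in\mathbb S^1$. $h_{\mathrm{top}}(f)$ is the topological entropy of $f$. For a continuous map $f:X\to X$ of a compact metric space $(X,d)$, a set $A\subset X$ is $(n,\varepsilon)$-separated if for all distinct $x,y\in A$ there is $0\le j<n$ with $d(f^j(x),f^j(y))>\varepsilon$. For closed $K\subset X$, $S(n,\varepsilon,K)$ denotes the maximal cardinality of an $(n,\varepsilon)$-separated subset of $K$. For $\omega\ge0$ and $z\in X$, the upper translocal entropy at $z$ is $$\overline h_\omega(z)=\lim_{\varepsilon\to0}\limsup_{n\to\infty}\frac1n\log S\big(n,\varepsilon,\overline{B(z,e^{-\omega n})}\big),$$ and the lower translocal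 entropy $\underline h_\omega(z)$ is defined in the same way with $\liminf_{n\to\infty}$ in place of $\limsup_{n\to\infty}$. Here $B(z,\rho)$ is the metric ball of radius $\rho$ around $z$. *)

theory Defs
  imports "HOL-Analysis.Analysis"
begin

quotient_type circle = real / "\<lambda>x y :: real. x - y \<in> \<int>"
  morphisms rep_circle circle_of
proof (rule equivpI)
  show "reflp (\<lambda>x y :: real. x - y \<in> \<int>)"
    by (simp add: reflp_def)
  show "symp (\<lambda>x y :: real. x - y \<in> \<int>)"
  proof (rule sympI)
    fix x y :: real
    assume "x - y \<in> \<int>"
    then have "- (x - y) \<in> \<int>" by (rule Ints_minus)
    then show "y - x \<in> \<int>" by simp
  qed
  show "transp (\<lambda>x y :: real. x - y \<in> \<int>)"
  proof (rule transpI)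
    fix x y z :: real
    assume "x - y \<in> \<int>" "y - z \<in> \<int>"
    then have "(x - y) + (y - z) \<in> \<int>" by (rule Ints_add)
    then show "x - z \<in> \<int>" by simp
  qed
qed

lemma circle_of_eq_iff: "circle_of x = circle_of y \<longleftrightarrow> x - y \<in> \<int>"
  by (rule circle.abs_eq_iff)

lemma circle_of_cases: obtains x where "z = circle_of x"
proof -
  have "\<exists>x. z = circle_of x" by (induct z) blast
  then show thesis using that by blast
qed

text \<open>The metric is the distance from \<open>x - y\<close> to the nearest integer; how \<open>round\<close> breaks ties
  is irrelevant.\<close>

instantiation circle :: metric_space
begin

lift_definition dist_circle :: "circle \<Rightarrow> circle \<Rightarrow> real"
  is "\<lambda>x y. \<bar>(x - y) - of_int (round (x - y))\<bar>"
proof -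
  fix x x' y y' :: real
  assume "x - x' \<in> \<int>" "y - y' \<in> \<int>"
  then obtain k l :: int where "x - x' = of_int k" "y - y' = of_int l"
    by (auto elim!: Ints_cases)
  then have *: "x - y = (x' - y') + of_int (k - l)" by simp
  have le: "\<bar>u - of_int (round u)\<bar> \<le> \<bar>v - of_int (round v)\<bar>"
    if "u = v + of_int m" for u v :: real and m :: int
    using round_diff_minimal[of u "round v + m"] that by simp
  show "\<bar>(x - y) - of_int (round (x - y))\<bar> = \<bar>(x' - y') - of_int (round (x' - y'))\<bar>"
    using le[OF *] le[of "x' - y'" "x - y" "l - k"] * by simp
qed

definition uniformity_circle :: "(circle \<times> circle) filter" where
  "uniformity_circle = (INF e\<in>{0<..}. principal {(x, y). dist x y < e})"

definition open_circle :: "circle set \<Rightarrow> bool" where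
  "open_circle U \<longleftrightarrow> (\<forall>x\<in>U. \<forall>\<^sub>F (x', y) in uniformity. x' = x \<longrightarrow> y \<in> U)"

instance
proof
  show "uniformity = (INF e\<in>{0<..}. principal {(x, y :: circle). dist x y < e})"
    by (rule uniformity_circle_def)
  show "open U \<longleftrightarrow> (\<forall>x\<in>U. \<forall>\<^sub>F (x', y) in uniformity. x' = x \<longrightarrow> y \<in> U)" for U :: "circle set"
    by (rule open_circle_def)
  show "dist x y = 0 \<longleftrightarrow> x = y" for x y :: circle
  proof transfer
    fix x y :: real
    show "\<bar>(x - y) - of_int (round (x - y))\<bar> = 0 \<longleftrightarrow> x - y \<in> \<int>"
    proof
      assume "\<bar>(x - y) - of_int (round (x - y))\<bar> = 0"
      then have "x - y = of_int (round (x - y))" by simp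
      then show "x - y \<in> \<int>" by (rule subst[OF sym]) simp
    next
      assume "x - y \<in> \<int>"
      then show "\<bar>(x - y) - of_int (round (x - y))\<bar> = 0"
        by (elim Ints_cases) simp
    qed
  qed
  show "dist x y \<le> dist x z + dist y z" for x y z :: circle
  proof transfer
    fix x y z :: real
    show "\<bar>(x - y) - of_int (round (x - y))\<bar>
      \<le> \<bar>(x - z) - of_int (round (x - z))\<bar> + \<bar>(y - z) - of_int (round (y - z))\<bar>"
      using round_diff_minimal[of "x - y" "round (x - z) - round (y - z)"] by simp
  qed
qed

end

lemma dist_circle_of: "dist (circle_of x) (circle_of y) = \<bar>(x - y) - of_int (round (x - y))\<bar>"
  by (rule dist_circle.abs_eq)

lemma dist_circle_of_le: "dist (circle_of x) (circle_of y) \<le> dist x y"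
  using round_diff_minimal[of "x - y" 0] by (simp add: dist_circle_of dist_real_def)

lemma continuous_on_circle_of: "continuous_on S circle_of"
  unfolding continuous_on_iff by (blast intro: le_less_trans[OF dist_circle_of_le])

lemma compact_circle: "compact (UNIV :: circle set)"
proof -
  have "z \<in> circle_of ` {0..1}" for z
  proof -
    obtain x where "z = circle_of x" by (rule circle_of_cases)
    also have "\<dots> = circle_of (frac x)"
      by (simp add: circle_of_eq_iff frac_def)
    finally show ?thesis
      by (simp add: frac_lt_1 less_imp_le)
  qed
  then have "circle_of ` {0..1} = UNIV" by blast
  moreover have "compact (circle_of ` {0..1})"
    by (rule compact_continuous_image[OF continuous_on_circle_of compact_Icc])
  ultimately show ?thesis by simp
qed

text \<open>Derivatives of circle maps are taken in the charts given by \<open>circle_of\<close>, that is, as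
  derivatives of lifts to the real line. Two lifts of the same map differ by an integer constant,
  so the derivative depends neither on the lift nor on the point above \<open>z\<close>.\<close>

definition circle_lift :: "(circle \<Rightarrow> circle) \<Rightarrow> (real \<Rightarrow> real) \<Rightarrow> bool" where
  "circle_lift f F \<longleftrightarrow> continuous_on UNIV F \<and> (\<forall>x. f (circle_of x) = circle_of (F x))"

definition circle_C2 :: "(circle \<Rightarrow> circle) \<Rightarrow> bool" where
  "circle_C2 f \<longleftrightarrow> (\<exists>F F' F''. circle_lift f F
     \<and> (\<forall>x. (F has_real_derivative F' x) (at x))
     \<and> (\<forall>x. (F' has_real_derivative F'' x) (at x))
     \<and> continuous_on UNIV F'')"

definition circle_deriv :: "(circle \<Rightarrow> circle) \<Rightarrow> circle \<Rightarrow> real" where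
  "circle_deriv f z =
     (THE D. \<exists>F x. circle_lift f F \<and> circle_of x = z \<and> (F has_real_derivative D) (at x))"

definition expanding :: "(circle \<Rightarrow> circle) \<Rightarrow> bool" where
  "expanding f \<longleftrightarrow> (\<exists>c>1. \<forall>z. \<bar>circle_deriv f z\<bar> \<ge> c)"

lemma circle_lift_diff_const:
  assumes F: "circle_lift f F" and G: "circle_lift f G" and k: "k \<in> \<int>"
  obtains m where "\<And>x. G (x + k) = F x + m"
proof -
  define H where "H = (\<lambda>x. G (x + k) - F x)"
  have "continuous_on UNIV F" "continuous_on UNIV G"
    using F G by (auto simp: circle_lift_def)
  moreover have "continuous_on UNIV (\<lambda>x. x + k)"
    by (intro continuous_intros)
  ultimately have cont: "continuous_on UNIV H"
    unfolding H_def using continuous_on_compose2[of UNIV G UNIV "\<lambda>x. x + k"]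
    by (simp add: continuous_on_diff)
  have int: "H x \<in> \<int>" for x
  proof -
    have "circle_of (G (x + k)) = f (circle_of (x + k))"
      using G by (simp add: circle_lift_def)
    also have "circle_of (x + k) = circle_of x"
      using k by (simp add: circle_of_eq_iff)
    also have "f (circle_of x) = circle_of (F x)"
      using F by (simp add: circle_lift_def)
    finally show ?thesis by (simp add: circle_of_eq_iff H_def)
  qed
  have disc: "\<exists>e>0. \<forall>y. y \<in> UNIV \<and> H y \<noteq> H x \<longrightarrow> e \<le> norm (H y - H x)" for x
    using int by (intro exI[of _ 1]) (auto intro!: Ints_nonzero_abs_ge1 Ints_diff)
  have "H constant_on UNIV"
    using continuous_discrete_range_constant[OF connected_UNIV cont] disc by blast
  then obtain m where "\<And>x. H x = m" by (auto simp: constant_on_def)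
  then show thesis by (intro that[of m]) (simp add: H_def algebra_simps)
qed

lemma circle_deriv_eq:
  assumes F: "circle_lift f F" and D: "(F has_real_derivative D) (at x)"
  shows "circle_deriv f (circle_of x) = D"
  unfolding circle_deriv_def
proof (rule the_equality)
  show "\<exists>F y. circle_lift f F \<and> circle_of y = circle_of x \<and> (F has_real_derivative D) (at y)"
    using assms by blast
  fix E assume "\<exists>G y. circle_lift f G \<and> circle_of y = circle_of x \<and> (G has_real_derivative E) (at y)"
  then obtain G y where G: "circle_lift f G" and y: "y - x \<in> \<int>"
    and E: "(G has_real_derivative E) (at y)"
    by (auto simp: circle_of_eq_iff)
  obtain m where m: "\<And>t. G (t + (y - x)) = F t + m"
    using circle_lift_diff_const[OF F G y] by blast
  have "((\<lambda>t. G (t + (y - x))) has_real_derivative E) (at x)"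
    using E DERIV_shift[of G E x "y - x"] by simp
  then have "((\<lambda>t. F t + m) has_real_derivative E) (at x)"
    by (simp add: m)
  moreover have "((\<lambda>t. F t + m) has_real_derivative D) (at x)"
    using D by (auto intro!: derivative_eq_intros)
  ultimately show "E = D" by (rule DERIV_unique)
qed

definition separated :: "('a::metric_space \<Rightarrow> 'a) \<Rightarrow> nat \<Rightarrow> real \<Rightarrow> 'a set \<Rightarrow> bool" where
  "separated f n \<epsilon> A \<longleftrightarrow>
     (\<forall>x\<in>A. \<forall>y\<in>A. x \<noteq> y \<longrightarrow> (\<exists>j<n. dist ((f ^^ j) x) ((f ^^ j) y) > \<epsilon>))"

text \<open>The maximum exists when the space is compact, \<open>f\<close> is continuous and \<open>\<epsilon> > 0\<close>, the only
  situation in which this is used. It is then antimonotone in \<open>\<epsilon>\<close>, so that the limits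
  as \<open>\<epsilon>\<close> tends to 0 below exist in \<open>ereal\<close>.\<close>

definition max_separated :: "('a::metric_space \<Rightarrow> 'a) \<Rightarrow> nat \<Rightarrow> real \<Rightarrow> 'a set \<Rightarrow> nat" where
  "max_separated f n \<epsilon> K = Max {card A | A. A \<subseteq> K \<and> finite A \<and> separated f n \<epsilon> A}"

definition h_top :: "('a::metric_space \<Rightarrow> 'a) \<Rightarrow> ereal" where
  "h_top f = Lim (at_right 0) (\<lambda>\<epsilon>. limsup (\<lambda>n.
     ereal (1 / real n * ln (real (max_separated f n \<epsilon> UNIV)))))"

definition upper_translocal_entropy :: "('a::metric_space \<Rightarrow> 'a) \<Rightarrow> real \<Rightarrow> 'a \<Rightarrow> ereal" where
  "upper_translocal_entropy f \<omega> z = Lim (at_right 0) (\<lambda>\<epsilon>. limsup (\<lambda>n.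
     ereal (1 / real n * ln (real (max_separated f n \<epsilon> (closure (ball z (exp (- \<omega> * real n)))))))))"

definition lower_translocal_entropy :: "('a::metric_space \<Rightarrow> 'a) \<Rightarrow> real \<Rightarrow> 'a \<Rightarrow> ereal" where
  "lower_translocal_entropy f \<omega> z = Lim (at_right 0) (\<lambda>\<epsilon>. liminf (\<lambda>n.
     ereal (1 / real n * ln (real (max_separated f n \<epsilon> (closure (ball z (exp (- \<omega> * real n)))))))))"

definition upper_lyapunov :: "(circle \<Rightarrow> circle) \<Rightarrow> circle \<Rightarrow> ereal" where
  "upper_lyapunov f z = limsup (\<lambda>n. ereal (1 / real n * ln \<bar>circle_deriv (f ^^ n) z\<bar>))"

definition lower_lyapunov :: "(circle \<Rightarrow> circle) \<Rightarrow> circle \<Rightarrow> ereal" where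
  "lower_lyapunov f z = liminf (\<lambda>n. ereal (1 / real n * ln \<bar>circle_deriv (f ^^ n) z\<bar>))"

end

theory Submission
  imports Defs
begin

text \<open>Let \<open>F\<close> be a lift of \<open>f\<close>, \<open>d\<close> its degree and \<open>h = ln \<bar>d\<bar>\<close>. Expansion makes
  \<open>S(n, \<epsilon>, I)\<close>, for a short arc \<open>I\<close> and small \<open>\<epsilon>\<close>, comparable to the length of \<open>F\<^sup>n I\<close>.
  By bounded distortion the arc of radius \<open>exp (- \<omega> n)\<close> about \<open>z\<close> is stretched to length about
  1 at the time \<open>m\<close> at which \<open>a\<^sub>m = ln \<bar>DF\<^sup>m z\<bar>\<close> passes \<open>\<omega> n\<close>, and afterwards its length grows
  like \<open>\<bar>d\<bar>\<^sup>k\<close>. So \<open>ln S = max 0 (n - m) * h\<close> up to a constant, and since \<open>m / n\<close> is close to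
  \<open>\<omega> m / a\<^sub>m\<close>, its upper and lower limits are \<open>\<omega>\<close> divided by the lower and upper Lyapunov
  exponents. The entropy of \<open>f\<close> is the case \<open>\<omega> = 0\<close>.\<close>

section \<open>Comparison of growth rates\<close>

text \<open>Separation counts are only known up to bounded factors, so rates are known up to a null
  sequence; \<open>e\<close> carries that error. For a lower bound on a limsup, infinitely many
  indices suffice.\<close>

lemma le_limsupI:
  fixes s e :: "nat \<Rightarrow> real"
  assumes "\<exists>\<^sub>F n in sequentially. g - e n \<le> s n" "e \<longlonglongrightarrow> 0"
  shows "ereal g \<le> limsup (\<lambda>n. ereal (s n))"
proof (rule ccontr)
  assume "\<not> ?thesis"
  then have "limsup (\<lambda>n. ereal (s n)) < ereal g" by (simp add: not_le)
  then obtain y where y: "limsup (\<lambda>n. ereal (s n)) < y" "y < ereal g"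
    using dense by blast
  have "(\<lambda>n. ereal (g - e n)) \<longlonglongrightarrow> ereal (g - 0)"
    by (intro tendsto_ereal tendsto_diff tendsto_const assms(2))
  then have "\<forall>\<^sub>F n in sequentially. y < ereal (g - e n)"
    by (rule order_tendstoD(1)) (simp add: y)
  moreover have "\<forall>\<^sub>F n in sequentially. ereal (s n) < y"
    using y(1) by (rule Limsup_lessD)
  ultimately have "\<forall>\<^sub>F n in sequentially. \<not> g - e n \<le> s n"
    by eventually_elim (metis ereal_less_eq(3) leD less_trans)
  then show False using assms(1) by (simp add: frequently_def)
qed

lemma liminf_leI:
  fixes s e :: "nat \<Rightarrow> real"
  assumes "\<exists>\<^sub>F n in sequentially. s n \<le> g + e n" "e \<longlonglongrightarrow> 0"
  shows "liminf (\<lambda>n. ereal (s n)) \<le> ereal g"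
proof -
  have "ereal (- g) \<le> limsup (\<lambda>n. ereal (- s n))"
  proof (rule le_limsupI[OF _ assms(2)])
    show "\<exists>\<^sub>F n in sequentially. - g - e n \<le> - s n"
      using assms(1) by (rule frequently_elim1) simp
  qed
  also have "\<dots> = - liminf (\<lambda>n. ereal (s n))"
    using ereal_Limsup_uminus[of sequentially "\<lambda>n. ereal (s n)"] by simp
  finally show ?thesis using ereal_minus_le_minus[of "ereal g" "liminf (\<lambda>n. ereal (s n))"] by simp
qed

lemma limsup_leI:
  fixes s e :: "nat \<Rightarrow> real"
  assumes "\<forall>\<^sub>F n in sequentially. s n \<le> g + e n" "e \<longlonglongrightarrow> 0"
  shows "limsup (\<lambda>n. ereal (s n)) \<le> ereal g"
proof -
  have "(\<lambda>n. ereal (g + e n)) \<longlonglongrightarrow> ereal (g + 0)"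
    by (intro tendsto_ereal tendsto_add tendsto_const assms(2))
  then have "limsup (\<lambda>n. ereal (g + e n)) = ereal g"
    using lim_imp_Limsup[OF sequentially_bot, of _ "ereal (g + 0)"] by simp
  moreover have "limsup (\<lambda>n. ereal (s n)) \<le> limsup (\<lambda>n. ereal (g + e n))"
    using assms(1) by (intro Limsup_mono) simp
  ultimately show ?thesis by simp
qed

lemma le_liminfI:
  fixes s e :: "nat \<Rightarrow> real"
  assumes "\<forall>\<^sub>F n in sequentially. g - e n \<le> s n" "e \<longlonglongrightarrow> 0"
  shows "ereal g \<le> liminf (\<lambda>n. ereal (s n))"
proof -
  have "limsup (\<lambda>n. ereal (- s n)) \<le> ereal (- g)"
  proof (rule limsup_leI[OF _ assms(2)])
    show "\<forall>\<^sub>F n in sequentially. - s n \<le> - g + e n"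
      using assms(1) by eventually_elim simp
  qed
  then have "- liminf (\<lambda>n. ereal (s n)) \<le> - ereal g"
    using ereal_Limsup_uminus[of sequentially "\<lambda>n. ereal (s n)"] by simp
  then show ?thesis by (simp only: ereal_minus_le_minus)
qed

text \<open>The dynamics reduced to two sequences: \<open>a m\<close> stands for the logarithm of
  the derivative of the m-th iterate at \<open>z\<close>, and \<open>real n * s n\<close> for the
  logarithm of the separation count in the shrinking ball. The bounds are required for every m on
  the proper side of the crossing time, so that each limit below can choose its own m. The disjunct
  \<open>m = 0\<close> provides an upper bound even when no time satisfies the inequality.\<close>

locale growth_rates =
  fixes a s :: "nat \<Rightarrow> real" and \<omega> h K :: real
  assumes \<omega>: "0 \<le> \<omega>" and h: "0 \<le> h" and K: "0 \<le> K"
    and a_mono: "mono a" and a_at_top: "filterlim a at_top sequentially"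
    and s_nonneg: "0 \<le> s n"
    and s_le: "0 < n \<Longrightarrow> m \<le> n \<Longrightarrow> m = 0 \<or> a m \<le> \<omega> * real n - K
      \<Longrightarrow> real n * s n \<le> K + real (n - m) * h"
    and s_ge: "0 < n \<Longrightarrow> m \<le> n \<Longrightarrow> \<omega> * real n + K \<le> a m
      \<Longrightarrow> real (n - m) * h - K \<le> real n * s n"
begin

text \<open>The expected translocal entropy at a point with Lyapunov exponent \<open>\<mu>\<close>.
  Faster expansion reaches unit length earlier and leaves more time for growth at rate
  \<open>h\<close>, so upper bounds on \<open>a\<close> give upper bounds on
  \<open>s\<close>.\<close>

definition g :: "real \<Rightarrow> real" where
  "g \<mu> = max 0 ((1 - \<omega> / \<mu>) * h)"

lemma s_le_g:
  assumes n: "0 < n" and m: "m = 0 \<or> a m \<le> \<omega> * real n - K"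
    and C: "\<omega> / \<mu> * real n - C \<le> real m" "0 \<le> C"
  shows "s n \<le> g \<mu> + (K + C * h) / real n"
proof -
  have "real n * s n \<le> K + max 0 (real n - real m) * h"
  proof (cases "m \<le> n")
    case True
    then show ?thesis using s_le[OF n True m] by (simp add: of_nat_diff)
  next
    case False
    \<comment> \<open>A time beyond \<open>n\<close> is replaced by \<open>n\<close> itself, which
      is admissible because \<open>a\<close> is increasing.\<close>
    then have "m \<noteq> 0" "a n \<le> a m" using monoD[OF a_mono, of n m] by auto
    then have "real n * s n \<le> K + real (n - n) * h" using m n by (intro s_le) auto
    then show ?thesis using False by simp
  qed
  also have "max 0 (real n - real m) \<le> max 0 ((1 - \<omega> / \<mu>) * real n) + C"
    using C by (simp add: algebra_simps max_def)
  then have "K + max 0 (real n - real m) * h \<le> K + (max 0 ((1 - \<omega> / \<mu>) * real n) + C) * h"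
    using h by (intro add_left_mono mult_right_mono)
  also have "\<dots> = real n * (g \<mu> + (K + C * h) / real n)"
    using n h by (simp add: g_def field_simps max_mult_distrib_right max_mult_distrib_left)
  finally show ?thesis using n by simp
qed

lemma s_ge_g:
  assumes n: "0 < n" and m: "\<omega> * real n + K \<le> a m"
    and C: "real m \<le> \<omega> / \<mu> * real n + C" "0 \<le> C"
  shows "g \<mu> - (K + C * h) / real n \<le> s n"
proof -
  have "(real n - real m) * h - K \<le> real n * s n"
  proof (cases "m \<le> n")
    case True
    then show ?thesis using s_ge[OF n True m] by (simp add: of_nat_diff)
  next
    case False
    \<comment> \<open>For times beyond \<open>n\<close> the claimed bound is not positive, while
      \<open>s\<close> is nonnegative.\<close>
    then have "(real n - real m) * h \<le> 0" using h by (intro mult_nonpos_nonneg) auto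
    moreover have "0 \<le> real n * s n" using s_nonneg by simp
    ultimately show ?thesis using K by linarith
  qed
  moreover have "((1 - \<omega> / \<mu>) * real n - C) * h \<le> (real n - real m) * h"
    using h C by (intro mult_right_mono) (auto simp: algebra_simps)
  ultimately have "((1 - \<omega> / \<mu>) * real n - C) * h - K \<le> real n * s n" by linarith
  moreover have "((1 - \<omega> / \<mu>) * real n - C) * h - K = real n * ((1 - \<omega> / \<mu>) * h - (K + C * h) / real n)"
    using n by (simp add: field_simps)
  ultimately have "(1 - \<omega> / \<mu>) * h - (K + C * h) / real n \<le> s n"
    using n by (metis mult_le_cancel_left_pos of_nat_0_less_iff)
  moreover have "- ((K + C * h) / real n) \<le> s n"
    proof -
    have "0 \<le> (K + C * h) / real n" using K h C(2) by simp
    then show ?thesis using s_nonneg[of n] by linarith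
  qed
  ultimately show ?thesis by (simp add: g_def)
qed

lemma null_sequence: "(\<lambda>n. c / real n) \<longlonglongrightarrow> 0"
  by (rule lim_const_over_n)

lemma limsup_le_g:
  assumes "0 < \<mu>" and ev: "\<forall>\<^sub>F m in sequentially. a m \<le> \<mu> * real m"
  shows "limsup (\<lambda>n. ereal (s n)) \<le> ereal (g \<mu>)"
proof -
  obtain m\<^sub>0 where m\<^sub>0: "\<And>m. m\<^sub>0 \<le> m \<Longrightarrow> a m \<le> \<mu> * real m"
    using ev unfolding eventually_sequentially by blast
  \<comment> \<open>The constant pays for the times before \<open>m\<^sub>0\<close>, for the shift
    by \<open>K\<close> and for rounding.\<close>
  define C where "C = real m\<^sub>0 + K / \<mu> + 1"
  have "s n \<le> g \<mu> + (K + C * h) / real n" if n: "0 < n" for n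
  proof -
    define x where "x = (\<omega> * real n - K) / \<mu>"
    have x: "\<omega> / \<mu> * real n = x + K / \<mu>" by (simp add: x_def diff_divide_distrib)
    have "0 \<le> K / \<mu>" using K \<open>0 < \<mu>\<close> by simp
    show ?thesis
    proof (cases "real m\<^sub>0 \<le> x")
      case True
      \<comment> \<open>The last time at which the linear bound on \<open>a\<close> still guarantees
        \<open>a m \<le> \<omega> * real n - K\<close>.\<close>
      define m where "m = nat \<lfloor>x\<rfloor>"
      have m: "real m \<le> x" "x \<le> real m + 1" "m\<^sub>0 \<le> m"
        using True unfolding m_def by linarith+
      then have "a m \<le> \<mu> * x" using m\<^sub>0[of m] \<open>0 < \<mu>\<close> by (meson mult_le_cancel_left_pos order_trans)
      then have "a m \<le> \<omega> * real n - K" using \<open>0 < \<mu>\<close> by (simp add: x_def)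
      then show ?thesis using m x \<open>0 \<le> K / \<mu>\<close> by (intro s_le_g[OF n, of m]) (auto simp: C_def)
    next
      case False
      \<comment> \<open>The target \<open>x\<close> lies before \<open>m\<^sub>0\<close>, so
        \<open>\<omega> / \<mu> * real n\<close> is below \<open>C\<close> and time 0 loses only a
        constant.\<close>
      then show ?thesis using x \<open>0 \<le> K / \<mu>\<close> by (intro s_le_g[OF n, of 0]) (auto simp: C_def)
    qed
  qed
  then show ?thesis
    by (intro limsup_leI[OF _ null_sequence]) (auto intro: eventually_mono[OF eventually_gt_at_top[of 0]])
qed

lemma g_le_liminf:
  assumes "0 < \<mu>" and ev: "\<forall>\<^sub>F m in sequentially. \<mu> * real m \<le> a m"
  shows "ereal (g \<mu>) \<le> liminf (\<lambda>n. ereal (s n))"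
proof -
  obtain m\<^sub>0 where m\<^sub>0: "\<And>m. m\<^sub>0 \<le> m \<Longrightarrow> \<mu> * real m \<le> a m"
    using ev unfolding eventually_sequentially by blast
  define C where "C = real m\<^sub>0 + K / \<mu> + 1"
  have "g \<mu> - (K + C * h) / real n \<le> s n" if n: "0 < n" for n
  proof -
    define x where "x = (\<omega> * real n + K) / \<mu>"
    have x: "\<omega> / \<mu> * real n = x - K / \<mu>" by (simp add: x_def add_divide_distrib)
    have "0 \<le> K / \<mu>" "0 \<le> x" using K \<omega> \<open>0 < \<mu>\<close> by (auto simp: x_def)
    \<comment> \<open>Adding \<open>m\<^sub>0\<close> instead of taking a maximum keeps the linear
      bound available at the cost of a constant.\<close>
    define m where "m = m\<^sub>0 + nat \<lceil>x\<rceil>"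
    have m: "x \<le> real m" "real m \<le> x + real m\<^sub>0 + 1" "m\<^sub>0 \<le> m"
      using \<open>0 \<le> x\<close> unfolding m_def by linarith+
    then have "\<mu> * x \<le> a m" using m\<^sub>0[of m] \<open>0 < \<mu>\<close> by (meson mult_le_cancel_left_pos order_trans)
    then have "\<omega> * real n + K \<le> a m" using \<open>0 < \<mu>\<close> by (simp add: x_def)
    then show ?thesis using m x \<open>0 \<le> K / \<mu>\<close> by (intro s_ge_g[OF n, of m]) (auto simp: C_def)
  qed
  then show ?thesis
    by (intro le_liminfI[OF _ null_sequence]) (auto intro: eventually_mono[OF eventually_gt_at_top[of 0]])
qed

lemma frequently_large:
  assumes "\<exists>\<^sub>F m in sequentially. P m"
  obtains m where "P m" "b \<le> a m"
proof -
  have "\<forall>\<^sub>F m in sequentially. b \<le> a m"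
    using a_at_top by (simp add: filterlim_at_top)
  then have "\<exists>\<^sub>F m in sequentially. P m \<and> b \<le> a m"
    using assms by (intro frequently_eventually_frequently)
  then show thesis using that by (auto dest: frequently_ex)
qed

text \<open>The favourable times m are now given, and there are merely infinitely many of them, so
  the roles are exchanged: each m determines a scale n for which it is nearly the crossing time. As
  \<open>a\<close> is unbounded, these n become arbitrarily large.\<close>

lemma g_le_limsup:
  assumes "0 < \<mu>" and fr: "\<exists>\<^sub>F m in sequentially. \<mu> * real m \<le> a m"
  shows "ereal (g \<mu>) \<le> limsup (\<lambda>n. ereal (s n))"
proof -
  have "\<exists>C. \<exists>\<^sub>F n in sequentially. g \<mu> - (K + C * h) / real n \<le> s n"
  proof (cases "\<omega> = 0")
    case True
    \<comment> \<open>With \<omega> = 0 times cannot be turned into scales, but one m beyond the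
      fixed level \<open>K\<close> serves every n, with \<open>real m\<close> as the
      constant.\<close>
    obtain m where "K \<le> a m" using frequently_large[OF fr] by blast
    then have "g \<mu> - (K + real m * h) / real n \<le> s n" if "0 < n" for n
      using that True by (intro s_ge_g[of n m]) auto
    then have "\<exists>\<^sub>F n in sequentially. g \<mu> - (K + real m * h) / real n \<le> s n"
      by (intro eventually_frequently eventually_mono[OF eventually_gt_at_top[of 0]]) auto
    then show ?thesis by blast
  next
    case False
    then have \<omega>': "0 < \<omega>" using \<omega> by simp
    define C where "C = (\<omega> + K) / \<mu>"
    have "\<exists>n\<ge>N. g \<mu> - (K + C * h) / real n \<le> s n" for N
    proof -
      obtain m where m: "\<mu> * real m \<le> a m" "K + \<omega> * (real N + 1) \<le> a m"
        using frequently_large[OF fr] by blast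
      define x where "x = (a m - K) / \<omega>"
      have am: "a m = \<omega> * x + K" using \<omega>' by (simp add: x_def)
      have "real N + 1 \<le> x" using m(2) \<omega>' by (simp add: x_def field_simps)
      \<comment> \<open>The largest n with \<open>\<omega> * real n + K \<le> a m\<close>; rounding
        costs at most \<open>\<omega>\<close>, which is the first summand in
        \<open>C\<close>.\<close>
      define n where "n = nat \<lfloor>x\<rfloor>"
      have n: "real n \<le> x" "x \<le> real n + 1" "N \<le> n" "0 < n"
        using \<open>real N + 1 \<le> x\<close> unfolding n_def by linarith+
      have "\<omega> * real n \<le> \<omega> * x" "\<omega> * x \<le> \<omega> * (real n + 1)"
        using n \<omega>' by (auto intro: mult_left_mono)
      then have "\<omega> * real n + K \<le> a m" "a m \<le> \<omega> * (real n + 1) + K" using am by auto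
      then have "\<mu> * real m \<le> \<omega> * (real n + 1) + K" using m(1) by linarith
      then have "real m \<le> (\<omega> * (real n + 1) + K) / \<mu>"
        using \<open>0 < \<mu>\<close> by (simp add: pos_le_divide_eq mult.commute)
      also have "\<dots> = \<omega> / \<mu> * real n + C" by (simp add: C_def add_divide_distrib algebra_simps)
      finally have "real m \<le> \<omega> / \<mu> * real n + C" .
      moreover have "0 \<le> C" using \<omega>' K \<open>0 < \<mu>\<close> by (simp add: C_def)
      ultimately show ?thesis
        using s_ge_g[OF \<open>0 < n\<close> \<open>\<omega> * real n + K \<le> a m\<close>, of \<mu> C] \<open>N \<le> n\<close> by blast
    qed
    then show ?thesis unfolding frequently_sequentially by blast
  qed
  then show ?thesis using le_limsupI[OF _ null_sequence] by blast
qed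

lemma liminf_le_g:
  assumes "0 < \<mu>" and fr: "\<exists>\<^sub>F m in sequentially. a m \<le> \<mu> * real m"
  shows "liminf (\<lambda>n. ereal (s n)) \<le> ereal (g \<mu>)"
proof -
  have "\<exists>C. \<exists>\<^sub>F n in sequentially. s n \<le> g \<mu> + (K + C * h) / real n"
  proof (cases "\<omega> = 0")
    case True
    then have "s n \<le> g \<mu> + (K + 0 * h) / real n" if "0 < n" for n
      using that by (intro s_le_g[of n 0]) auto
    then have "\<exists>\<^sub>F n in sequentially. s n \<le> g \<mu> + (K + 0 * h) / real n"
      by (intro eventually_frequently eventually_mono[OF eventually_gt_at_top[of 0]]) auto
    then show ?thesis by blast
  next
    case False
    then have \<omega>': "0 < \<omega>" using \<omega> by simp
    define C where "C = (\<omega> + K) / \<mu>"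
    have "\<exists>n\<ge>N. s n \<le> g \<mu> + (K + C * h) / real n" for N
    proof -
      obtain m where m: "a m \<le> \<mu> * real m" "\<omega> * (real N + 1) \<le> a m"
        using frequently_large[OF fr] by blast
      define x where "x = (a m + K) / \<omega>"
      have am: "a m = \<omega> * x - K" using \<omega>' by (simp add: x_def)
      have "\<omega> * (real N + 1) \<le> \<omega> * x" using m(2) K am by linarith
      then have "real N + 1 \<le> x" using \<omega>' by simp
      \<comment> \<open>Dually, the smallest n with
        \<open>a m \<le> \<omega> * real n - K\<close>.\<close>
      define n where "n = nat \<lceil>x\<rceil>"
      have n: "x \<le> real n" "real n \<le> x + 1" "N \<le> n" "0 < n"
        using \<open>real N + 1 \<le> x\<close> unfolding n_def by linarith+
      have "\<omega> * x \<le> \<omega> * real n" "\<omega> * real n \<le> \<omega> * (x + 1)"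
        using n \<omega>' by (auto intro: mult_left_mono)
      then have am': "a m \<le> \<omega> * real n - K" "\<omega> * real n - K - \<omega> \<le> a m"
        using am by (auto simp: algebra_simps)
      then have "\<omega> * real n - K - \<omega> \<le> \<mu> * real m" using m(1) by linarith
      then have "(\<omega> * real n - K - \<omega>) / \<mu> \<le> real m"
        using \<open>0 < \<mu>\<close> by (simp add: pos_divide_le_eq mult.commute)
      moreover have "(\<omega> * real n - K - \<omega>) / \<mu> = \<omega> / \<mu> * real n - C"
        by (simp add: C_def add_divide_distrib diff_divide_distrib)
      ultimately have "\<omega> / \<mu> * real n - C \<le> real m" by simp
      moreover have "0 \<le> C" using \<omega>' K \<open>0 < \<mu>\<close> by (simp add: C_def)
      ultimately show ?thesis
        using s_le_g[OF \<open>0 < n\<close>, of m \<mu> C] am' \<open>N \<le> n\<close> by blast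
    qed
    then show ?thesis unfolding frequently_sequentially by blast
  qed
  then show ?thesis using liminf_leI[OF _ null_sequence] by blast
qed

text \<open>The comparisons are available for rates \<open>\<mu>\<close> different from the exact
  exponent \<open>l\<close>; continuity of \<open>g\<close> at a positive \<open>l\<close> carries
  them over.\<close>

lemma g_limit_right:
  assumes "0 < l" and le: "\<And>\<mu>. l < \<mu> \<Longrightarrow> b \<le> ereal (g \<mu>)"
  shows "b \<le> ereal (g l)"
proof (rule tendsto_lowerbound)
  show "((\<lambda>\<mu>. ereal (g \<mu>)) \<longlongrightarrow> ereal (g l)) (at_right l)"
    unfolding g_def using \<open>0 < l\<close>
    by (intro tendsto_ereal tendsto_max tendsto_mult tendsto_diff tendsto_divide tendsto_const
        tendsto_ident_at) auto
  show "\<forall>\<^sub>F \<mu> in at_right l. b \<le> ereal (g \<mu>)"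
    using eventually_at_right_less[of l] by eventually_elim (rule le)
qed simp

lemma g_limit_left:
  assumes "0 < l" and le: "\<And>\<mu>. 0 < \<mu> \<Longrightarrow> \<mu> < l \<Longrightarrow> ereal (g \<mu>) \<le> b"
  shows "ereal (g l) \<le> b"
proof (rule tendsto_upperbound)
  show "((\<lambda>\<mu>. ereal (g \<mu>)) \<longlongrightarrow> ereal (g l)) (at_left l)"
    unfolding g_def using \<open>0 < l\<close>
    by (intro tendsto_ereal tendsto_max tendsto_mult tendsto_diff tendsto_divide tendsto_const
        tendsto_ident_at) auto
  show "\<forall>\<^sub>F \<mu> in at_left l. ereal (g \<mu>) \<le> b"
    using eventually_at_left[OF \<open>0 < l\<close>] le \<open>0 < l\<close> by blast
qed simp

text \<open>Every rate above \<open>l\<close> bounds \<open>a\<close> eventually and every rate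
  below \<open>l\<close> is exceeded infinitely often. These are the hypotheses of
  \<open>limsup_le_g\<close> and \<open>g_le_limsup\<close>.\<close>

lemma limsup_eq_g:
  assumes "limsup (\<lambda>m. ereal (1 / real m * a m)) = ereal l" "0 < l"
  shows "limsup (\<lambda>n. ereal (s n)) = ereal (g l)"
proof (rule antisym)
  have "limsup (\<lambda>n. ereal (s n)) \<le> ereal (g \<mu>)" if "l < \<mu>" for \<mu>
  proof (rule limsup_le_g)
    have "\<forall>\<^sub>F m in sequentially. ereal (1 / real m * a m) < ereal \<mu>"
      using assms(1) that by (intro Limsup_lessD) simp
    then show "\<forall>\<^sub>F m in sequentially. a m \<le> \<mu> * real m"
      using eventually_gt_at_top[of 0] by eventually_elim (simp add: field_simps)
  qed (use assms(2) that in simp)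
  then show "limsup (\<lambda>n. ereal (s n)) \<le> ereal (g l)"
    by (rule g_limit_right[OF assms(2)])
  have "ereal (g \<mu>) \<le> limsup (\<lambda>n. ereal (s n))" if "0 < \<mu>" "\<mu> < l" for \<mu>
  proof (rule g_le_limsup[OF that(1)])
    have "\<exists>\<^sub>F m in sequentially. ereal \<mu> < ereal (1 / real m * a m)"
    proof (rule ccontr)
      assume "\<not> ?thesis"
      then have "limsup (\<lambda>m. ereal (1 / real m * a m)) \<le> ereal \<mu>"
        by (intro Limsup_bounded) (simp add: frequently_def not_less)
      then show False using assms(1) that by simp
    qed
    then have "\<exists>\<^sub>F m in sequentially. ereal \<mu> < ereal (1 / real m * a m) \<and> 0 < m"
      using eventually_gt_at_top[of 0] by (intro frequently_eventually_frequently)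
    then show "\<exists>\<^sub>F m in sequentially. \<mu> * real m \<le> a m"
      by (rule frequently_elim1) (auto simp: field_simps)
  qed
  then show "ereal (g l) \<le> limsup (\<lambda>n. ereal (s n))"
    by (rule g_limit_left[OF assms(2)])
qed

lemma liminf_eq_g:
  assumes "liminf (\<lambda>m. ereal (1 / real m * a m)) = ereal l" "0 < l"
  shows "liminf (\<lambda>n. ereal (s n)) = ereal (g l)"
proof (rule antisym)
  have "liminf (\<lambda>n. ereal (s n)) \<le> ereal (g \<mu>)" if "l < \<mu>" for \<mu>
  proof (rule liminf_le_g)
    have "\<exists>\<^sub>F m in sequentially. ereal (1 / real m * a m) < ereal \<mu>"
    proof (rule ccontr)
      assume "\<not> ?thesis"
      then have "ereal \<mu> \<le> liminf (\<lambda>m. ereal (1 / real m * a m))"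
        by (intro Liminf_bounded) (simp add: frequently_def not_less)
      then show False using assms(1) that by simp
    qed
    then have "\<exists>\<^sub>F m in sequentially. ereal (1 / real m * a m) < ereal \<mu> \<and> 0 < m"
      using eventually_gt_at_top[of 0] by (intro frequently_eventually_frequently)
    then show "\<exists>\<^sub>F m in sequentially. a m \<le> \<mu> * real m"
      by (rule frequently_elim1) (auto simp: field_simps)
  qed (use assms(2) that in simp)
  then show "liminf (\<lambda>n. ereal (s n)) \<le> ereal (g l)"
    by (rule g_limit_right[OF assms(2)])
  have "ereal (g \<mu>) \<le> liminf (\<lambda>n. ereal (s n))" if "0 < \<mu>" "\<mu> < l" for \<mu>
  proof (rule g_le_liminf[OF that(1)])
    have "\<forall>\<^sub>F m in sequentially. ereal \<mu> < ereal (1 / real m * a m)"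
      using assms(1) that by (intro less_LiminfD) simp
    then show "\<forall>\<^sub>F m in sequentially. \<mu> * real m \<le> a m"
      using eventually_gt_at_top[of 0] by eventually_elim (simp add: field_simps)
  qed
  then show "ereal (g l) \<le> liminf (\<lambda>n. ereal (s n))"
    by (rule g_limit_left[OF assms(2)])
qed

end

section \<open>Separated sets on the circle\<close>

text \<open>Pigeonhole: half-open cells of width \<open>\<epsilon>\<close> contain at most one point
  each.\<close>

lemma card_spread_le:
  fixes T :: "real set"
  assumes "\<epsilon> > 0" and T: "T \<subseteq> {p..q}" and "p \<le> q"
    and sep: "\<And>s t. s \<in> T \<Longrightarrow> t \<in> T \<Longrightarrow> s \<noteq> t \<Longrightarrow> \<bar>s - t\<bar> > \<epsilon>"
  shows "finite T" and "real (card T) \<le> (q - p) / \<epsilon> + 1"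
proof -
  define g where "g t = \<lfloor>(t - p) / \<epsilon>\<rfloor>" for t
  have inj: "inj_on g T"
  proof (rule inj_onI)
    fix s t assume st: "s \<in> T" "t \<in> T" "g s = g t"
    then have "\<bar>(s - p) / \<epsilon> - (t - p) / \<epsilon>\<bar> < 1"
      unfolding g_def by linarith
    then have "\<bar>s - t\<bar> < \<epsilon>"
      using \<open>\<epsilon> > 0\<close> by (simp add: diff_divide_distrib[symmetric] abs_divide)
    then show "s = t" using sep[OF st(1,2)] by fastforce
  qed
  have "g ` T \<subseteq> {0..g q}"
  proof (intro image_subsetI)
    fix t assume "t \<in> T"
    then have "p \<le> t" "t \<le> q" using T by auto
    then show "g t \<in> {0..g q}"
      using \<open>\<epsilon> > 0\<close> by (simp add: g_def floor_mono divide_right_mono)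
  qed
  then have fin: "finite (g ` T)" and le: "card (g ` T) \<le> card {0..g q}"
    by (blast intro: finite_subset card_mono finite_atLeastAtMost_int)+
  then show "finite T" using inj finite_imageD by blast
  have "0 \<le> g q" using \<open>p \<le> q\<close> \<open>\<epsilon> > 0\<close> by (simp add: g_def)
  then have "real (card T) \<le> of_int (g q) + 1"
    using le card_image[OF inj] by simp
  also have "\<dots> \<le> (q - p) / \<epsilon> + 1" by (simp add: g_def)
  finally show "real (card T) \<le> (q - p) / \<epsilon> + 1" .
qed

text \<open>A continuous injective function of a real variable is strictly monotone, so
  displacements add along an interval. The absolute values cover both orientations.\<close>

lemma abs_diff_add_monotone:
  fixes G :: "real \<Rightarrow> real"
  assumes "continuous_on UNIV G" "inj G" "u \<le> v" "v \<le> w"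
  shows "\<bar>G u - G w\<bar> = \<bar>G u - G v\<bar> + \<bar>G v - G w\<bar>"
proof (cases "u < v \<and> v < w")
  case True
  moreover have "continuous_on {u..w} G" "inj_on G {u..w}"
    using assms(1,2) by (auto intro: continuous_on_subset inj_on_subset)
  ultimately have "G u < G v \<and> G v < G w \<or> G w < G v \<and> G v < G u"
    using continuous_inj_imp_mono[of u v w G] by blast
  then show ?thesis by linarith
next
  case False
  then show ?thesis using assms by auto
qed

lemma dist_circle_of_eq:
  assumes "\<bar>x - y\<bar> \<le> 1 / 2"
  shows "dist (circle_of x) (circle_of y) = \<bar>x - y\<bar>"
proof -
  have "\<bar>x - y\<bar> \<le> \<bar>(x - y) - of_int m\<bar>" for m :: int
  proof (cases "m = 0")
    case False
    then have "1 \<le> \<bar>real_of_int m\<bar>" by linarith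
    then show ?thesis using assms by linarith
  qed simp
  then show ?thesis
    using round_diff_minimal[of "x - y" 0] by (simp add: dist_circle_of order_antisym)
qed

lemma closure_ball_circle_subset:
  "closure (ball (circle_of x) r) \<subseteq> circle_of ` {x - r..x + r}"
proof
  fix w assume "w \<in> closure (ball (circle_of x) r)"
  then have w: "dist (circle_of x) w \<le> r"
    using closure_minimal[of "ball (circle_of x) r" "cball (circle_of x) r"] by auto
  obtain y where y: "w = circle_of y" by (rule circle_of_cases)
  \<comment> \<open>Among the representatives of \<open>w\<close>, one nearest to
    \<open>x\<close>.\<close>
  define y' where "y' = y + of_int (round (x - y))"
  have "circle_of y' = w" by (simp add: y y'_def circle_of_eq_iff)
  moreover have "y' \<in> {x - r..x + r}"
    using w by (auto simp: y y'_def dist_circle_of abs_le_iff)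
  ultimately show "w \<in> circle_of ` {x - r..x + r}" by blast
qed

lemma periodic_continuous_bounded:
  fixes G :: "real \<Rightarrow> real"
  assumes "continuous_on UNIV G" and per: "\<And>x. G (x + 1) = G x"
  obtains M where "\<And>x. \<bar>G x\<bar> \<le> M"
proof -
  have shift: "G (x + of_int k) = G x" for x k
  proof (induction k arbitrary: x rule: int_induct[of _ 0])
    case (step1 i)
    then show ?case using per[of "x + of_int i"] by (simp add: add.assoc)
  next
    case (step2 i)
    then show ?case using per[of "x + of_int (i - 1)"] by (simp add: algebra_simps)
  qed simp
  have "compact (G ` {0..1})"
    using assms(1) by (intro compact_continuous_image) (auto intro: continuous_on_subset)
  then have "bounded (G ` {0..1})" by (rule compact_imp_bounded)
  then obtain M where M: "\<And>y. y \<in> {0..1} \<Longrightarrow> \<bar>G y\<bar> \<le> M"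
    unfolding bounded_iff real_norm_def by blast
  have "\<bar>G x\<bar> \<le> M" for x
    using M[of "frac x"] shift[of "frac x" "\<lfloor>x\<rfloor>"] frac_lt_1[of x]
    by (simp add: frac_def)
  then show thesis by (rule that)
qed

text \<open>\<open>Max\<close> says nothing about an infinite set, so an a priori bound on all
  separated sets has to come along.\<close>

lemma card_le_max_separated:
  assumes "finite A" "A \<subseteq> K" "separated f n \<epsilon> A"
    and bound: "\<And>A. finite A \<Longrightarrow> A \<subseteq> K \<Longrightarrow> separated f n \<epsilon> A \<Longrightarrow> real (card A) \<le> M"
  shows "card A \<le> max_separated f n \<epsilon> K"
proof -
  have "{card A |A. A \<subseteq> K \<and> finite A \<and> separated f n \<epsilon> A} \<subseteq> {..nat \<lfloor>M\<rfloor>}"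
    using bound by (auto simp: le_nat_floor)
  then show ?thesis
    unfolding max_separated_def using assms(1-3)
    by (intro Max_ge) (auto intro: finite_subset)
qed

lemma max_separated_le:
  assumes "\<And>A. finite A \<Longrightarrow> A \<subseteq> K \<Longrightarrow> separated f n \<epsilon> A \<Longrightarrow> real (card A) \<le> M"
  shows "real (max_separated f n \<epsilon> K) \<le> M"
proof -
  let ?S = "{card A |A. A \<subseteq> K \<and> finite A \<and> separated f n \<epsilon> A}"
  have "?S \<subseteq> {..nat \<lfloor>M\<rfloor>}" using assms by (auto simp: le_nat_floor)
  then have "finite ?S" by (rule finite_subset) simp
  \<comment> \<open>The empty set is separated, so the maximum is taken over a nonempty set and is
    attained.\<close>
  moreover have "card {} \<in> ?S" unfolding mem_Collect_eq separated_def by (intro exI[of _ "{}"]) simp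
  ultimately have "Max ?S \<in> ?S" by (intro Max_in) auto
  then show ?thesis using assms unfolding max_separated_def by auto
qed

section \<open>Expanding lifts\<close>

text \<open>\<open>c\<close> and \<open>C\<close> bound the expansion from both sides,
  \<open>d\<close> is the degree, and \<open>B\<close> is a Lipschitz constant of the derivative,
  the form in which the second derivative enters the distortion estimate.\<close>

locale expanding_lift =
  fixes f :: "circle \<Rightarrow> circle" and F F' :: "real \<Rightarrow> real" and c C B :: real and d :: int
  assumes lift: "circle_lift f F"
    and deriv: "(F has_real_derivative F' x) (at x)"
    and c_gt_1: "1 < c" and c_le: "c \<le> \<bar>F' x\<bar>" and le_C: "\<bar>F' x\<bar> \<le> C"
    and lipschitz: "\<bar>F' x - F' y\<bar> \<le> B * \<bar>x - y\<bar>"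
    and degree: "F (x + 1) = F x + of_int d"
begin

section \<open>Iterates of the lift, their derivatives and their degree\<close>

definition D :: "nat \<Rightarrow> real \<Rightarrow> real" where
  "D n x = (\<Prod>i<n. F' ((F ^^ i) x))"

lemma DERIV_iterate: "((F ^^ n) has_real_derivative D n x) (at x)"
proof (induction n)
  case 0
  then show ?case by (simp add: D_def id_def)
next
  case (Suc n)
  show ?case
    using DERIV_chain[OF deriv Suc] by (simp add: D_def comp_def mult.commute)
qed

lemma continuous_iterate: "continuous_on S (F ^^ n)"
  using DERIV_iterate DERIV_continuous_on has_field_derivative_at_within by blast

lemma iterate_circle_of: "(f ^^ n) (circle_of x) = circle_of ((F ^^ n) x)"
  using lift by (induction n) (auto simp: circle_lift_def)

lemma circle_deriv_iterate: "circle_deriv (f ^^ n) (circle_of x) = D n x"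
  using circle_deriv_eq[OF _ DERIV_iterate]
  by (simp add: circle_lift_def continuous_iterate iterate_circle_of)

lemma MVT_iterate:
  obtains \<xi> where "min x y \<le> \<xi>" "\<xi> \<le> max x y"
    "\<bar>(F ^^ n) x - (F ^^ n) y\<bar> = \<bar>D n \<xi>\<bar> * \<bar>x - y\<bar>"
proof (cases "x = y")
  case True
  then show thesis using that[of x] by simp
next
  case False
  then have "min x y < max x y" by auto
  from MVT2[OF this, of "F ^^ n" "D n"] DERIV_iterate obtain \<xi>
    where \<xi>: "min x y < \<xi>" "\<xi> < max x y"
      "(F ^^ n) (max x y) - (F ^^ n) (min x y) = (max x y - min x y) * D n \<xi>"
    by blast
  have "\<bar>(F ^^ n) x - (F ^^ n) y\<bar> = \<bar>(F ^^ n) (max x y) - (F ^^ n) (min x y)\<bar>"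
    by (simp add: min_def max_def abs_minus_commute)
  also have "\<dots> = \<bar>D n \<xi>\<bar> * \<bar>x - y\<bar>"
    unfolding \<xi>(3) by (auto simp: abs_mult min_def max_def)
  finally show thesis using that[of \<xi>] \<xi> by simp
qed

lemma D_ge: "c ^ n \<le> \<bar>D n x\<bar>"
  using prod_mono[of "{..<n}" "\<lambda>_. c" "\<lambda>i. \<bar>F' ((F ^^ i) x)\<bar>"] c_gt_1 c_le
  by (simp add: D_def abs_prod)

lemma D_le: "\<bar>D n x\<bar> \<le> C ^ n"
  using prod_mono[of "{..<n}" "\<lambda>i. \<bar>F' ((F ^^ i) x)\<bar>" "\<lambda>_. C"] le_C
  by (simp add: D_def abs_prod)

lemma D_pos: "0 < \<bar>D n x\<bar>"
  using D_ge[of n x] zero_less_power[of c n] c_gt_1 by linarith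

lemma C_gt_1: "1 < C"
  using c_gt_1 c_le[of 0] le_C[of 0] by linarith

lemma step_ge: "c * \<bar>(F ^^ n) x - (F ^^ n) y\<bar> \<le> \<bar>(F ^^ Suc n) x - (F ^^ Suc n) y\<bar>"
proof -
  obtain \<xi> where "\<bar>(F ^^ 1) ((F ^^ n) x) - (F ^^ 1) ((F ^^ n) y)\<bar> = \<bar>D 1 \<xi>\<bar> * \<bar>(F ^^ n) x - (F ^^ n) y\<bar>"
    by (rule MVT_iterate)
  then show ?thesis using D_ge[of 1 \<xi>] by (simp add: mult_right_mono)
qed

lemma step_le: "\<bar>(F ^^ Suc n) x - (F ^^ Suc n) y\<bar> \<le> C * \<bar>(F ^^ n) x - (F ^^ n) y\<bar>"
proof -
  obtain \<xi> where "\<bar>(F ^^ 1) ((F ^^ n) x) - (F ^^ 1) ((F ^^ n) y)\<bar> = \<bar>D 1 \<xi>\<bar> * \<bar>(F ^^ n) x - (F ^^ n) y\<bar>"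
    by (rule MVT_iterate)
  then show ?thesis using D_le[of 1 \<xi>] by (simp add: mult_right_mono)
qed

text \<open>It lets a separation at any time before n be detected on the line at time n.\<close>

lemma iterate_distance_mono:
  "m \<le> n \<Longrightarrow> \<bar>(F ^^ m) x - (F ^^ m) y\<bar> \<le> \<bar>(F ^^ n) x - (F ^^ n) y\<bar>"
proof (induction n rule: dec_induct)
  case (step n)
  have "\<bar>(F ^^ n) x - (F ^^ n) y\<bar> \<le> c * \<bar>(F ^^ n) x - (F ^^ n) y\<bar>"
    using c_gt_1 by (simp add: mult_le_cancel_right1)
  then show ?case using step step_ge[of n x y] by linarith
qed simp

lemma inj_iterate: "inj (F ^^ n)"
proof (rule injI)
  fix x y assume "(F ^^ n) x = (F ^^ n) y"
  then show "x = y" using iterate_distance_mono[of 0 n x y] by simp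
qed

lemmas iterate_abs_diff_add = abs_diff_add_monotone[OF continuous_iterate inj_iterate]

lemma iterate_add_int: "(F ^^ n) (x + of_int k) = (F ^^ n) x + of_int (k * d ^ n)"
proof (induction n)
  case (Suc n)
  have shift: "F (y + of_int k) = F y + of_int (k * d)" for y k
  proof (induction k arbitrary: y rule: int_induct[of _ 0])
    case (step1 i)
    then show ?case using degree[of "y + of_int i"] by (simp add: algebra_simps)
  next
    case (step2 i)
    then show ?case using degree[of "y + of_int (i - 1)"] by (simp add: algebra_simps)
  qed simp
  show ?case using Suc shift[of "(F ^^ n) x" "k * d ^ n"] by (simp add: mult_ac)
qed simp

lemma iterate_unit: "\<bar>(F ^^ n) x - (F ^^ n) (x + 1)\<bar> = \<bar>of_int d\<bar> ^ n"
  using iterate_add_int[of n x 1] by (simp add: power_abs)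

lemma degree_gt_1: "1 < \<bar>real_of_int d\<bar>"
  \<comment> \<open>The points 0 and 1 have distance 1, and their images have distance equal to the
    modulus of the degree.\<close>
  using step_ge[of 0 0 1] degree[of 0] c_gt_1 by simp

text \<open>An interval of length at most 1 lies in a fundamental domain of the circle, and
  \<open>F ^^ n\<close> stretches every fundamental domain to length exactly
  \<open>\<bar>of_int d\<bar> ^ n\<close>. Together with the converse bound below, this makes growth
  from unit length onwards a matter of the degree, without derivatives.\<close>

lemma iterate_le_degree:
  assumes "\<bar>x - y\<bar> \<le> 1"
  shows "\<bar>(F ^^ n) x - (F ^^ n) y\<bar> \<le> \<bar>of_int d\<bar> ^ n"
  using assms
proof (induction x y rule: linorder_wlog)
  case (le x y)
  then show ?case
    using iterate_abs_diff_add[of x y "x + 1" n] iterate_unit[of n x] by linarith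
next
  case (sym x y)
  then show ?case by (simp add: abs_minus_commute)
qed

lemma iterate_ge_degree:
  assumes "\<bar>x - y\<bar> \<ge> 1"
  shows "\<bar>(F ^^ n) x - (F ^^ n) y\<bar> \<ge> \<bar>of_int d\<bar> ^ n"
  using assms
proof (induction x y rule: linorder_wlog)
  case (le x y)
  then show ?case
    using iterate_abs_diff_add[of x "x + 1" y n] iterate_unit[of n x] by linarith
next
  case (sym x y)
  then show ?case by (simp add: abs_minus_commute)
qed

lemma iterate_between:
  assumes "min x y \<le> \<xi>" "\<xi> \<le> max x y"
  shows "\<bar>(F ^^ n) x - (F ^^ n) \<xi>\<bar> \<le> \<bar>(F ^^ n) x - (F ^^ n) y\<bar>"
  using iterate_abs_diff_add[of x \<xi> y n] iterate_abs_diff_add[of y \<xi> x n] assms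
  by (cases "x \<le> y") (auto simp: abs_minus_commute)

section \<open>Bounded distortion\<close>

definition L :: "nat \<Rightarrow> real \<Rightarrow> real" where
  "L n x = ln \<bar>D n x\<bar>"

lemma exp_L: "exp (L n x) = \<bar>D n x\<bar>"
  unfolding L_def using D_pos[of n x] by (rule exp_ln)

lemma L_0: "L 0 x = 0"
  by (simp add: L_def D_def)

lemma L_Suc: "L (Suc n) x = L n x + L 1 ((F ^^ n) x)"
proof -
  have "D (Suc n) x = D n x * D 1 ((F ^^ n) x)" by (simp add: D_def)
  moreover have "D k y \<noteq> 0" for k y using D_pos[of k y] by simp
  ultimately show ?thesis by (simp add: L_def abs_mult ln_mult)
qed

lemma B_nonneg: "0 \<le> B"
  using lipschitz[of 0 1] by simp

text \<open>The logarithm is 1-Lipschitz above 1, where all values of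
  \<open>\<bar>F' x\<bar>\<close> lie, so the constant \<open>B\<close> passes from the derivative
  to its logarithm.\<close>

lemma L_1_diff_le: "L 1 x - L 1 y \<le> B * \<bar>x - y\<bar>"
proof -
  have gt: "1 < \<bar>F' z\<bar>" for z using c_gt_1 c_le[of z] by linarith
  define u v where "u = \<bar>F' x\<bar>" and "v = \<bar>F' y\<bar>"
  have uv: "1 < u" "1 < v" using gt by (auto simp: u_def v_def)
  have "L 1 x - L 1 y = ln u - ln v" by (simp add: L_def D_def u_def v_def)
  also have "\<dots> = ln (u / v)" using uv by (simp add: ln_div)
  also have "\<dots> \<le> u / v - 1" using uv by (intro ln_le_minus_one) auto
  also have "\<dots> = (u - v) / v" using uv by (simp add: diff_divide_distrib)
  also have "\<dots> \<le> \<bar>F' x - F' y\<bar> / 1" using uv by (intro frac_le) (auto simp: u_def v_def)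
  finally show ?thesis using lipschitz[of x y] by simp
qed

text \<open>The sum of the geometric series with terms B/c, B/c^2, and so on: Lipschitz errors added
  up backwards from the final distance.\<close>

definition \<kappa> :: real where "\<kappa> = B / (c - 1)"

lemma \<kappa>_nonneg: "0 \<le> \<kappa>"
  using B_nonneg c_gt_1 by (simp add: \<kappa>_def)

text \<open>The bound is stated in terms of the final distance because it then reproduces itself: the
  distance grows by the factor \<open>c\<close> in each step, and \<open>\<kappa> + B = \<kappa> * c\<close>.\<close>

lemma distortion: "L n x - L n y \<le> \<kappa> * \<bar>(F ^^ n) x - (F ^^ n) y\<bar>"
proof (induction n)
  case 0
  then show ?case using \<kappa>_nonneg by (simp add: L_0)
next
  case (Suc n)
  define t where "t = \<bar>(F ^^ n) x - (F ^^ n) y\<bar>"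
  have "L (Suc n) x - L (Suc n) y \<le> \<kappa> * t + B * t"
    using Suc L_1_diff_le[of "(F ^^ n) x" "(F ^^ n) y"]
    unfolding L_Suc t_def by linarith
  also have "\<dots> = \<kappa> * (c * t)"
    using c_gt_1 by (simp add: \<kappa>_def field_simps)
  also have "\<dots> \<le> \<kappa> * \<bar>(F ^^ Suc n) x - (F ^^ Suc n) y\<bar>"
    using step_ge \<kappa>_nonneg unfolding t_def by (intro mult_left_mono)
  finally show ?case .
qed

text \<open>While the image arc has length at most 1, distortion makes all derivatives along the arc
  comparable up to the factor \<open>exp \<kappa>\<close>.\<close>

lemma D_between:
  assumes "min x y \<le> \<xi>" "\<xi> \<le> max x y" "\<bar>(F ^^ n) x - (F ^^ n) y\<bar> \<le> 1"
  shows "\<bar>D n \<xi>\<bar> \<le> exp \<kappa> * \<bar>D n x\<bar>" and "\<bar>D n x\<bar> \<le> exp \<kappa> * \<bar>D n \<xi>\<bar>"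
proof -
  have "\<bar>(F ^^ n) x - (F ^^ n) \<xi>\<bar> \<le> 1" using iterate_between[OF assms(1,2), of n] assms(3) by linarith
  then have "\<kappa> * \<bar>(F ^^ n) x - (F ^^ n) \<xi>\<bar> \<le> \<kappa>"
    using \<kappa>_nonneg by (simp add: mult_left_le)
  then have "L n \<xi> \<le> \<kappa> + L n x" "L n x \<le> \<kappa> + L n \<xi>"
    using distortion[of n x \<xi>] distortion[of n \<xi> x] by (simp_all add: abs_minus_commute)
  then have "exp (L n \<xi>) \<le> exp (\<kappa> + L n x)" "exp (L n x) \<le> exp (\<kappa> + L n \<xi>)"
    by (simp_all only: exp_le_cancel_iff)
  then show "\<bar>D n \<xi>\<bar> \<le> exp \<kappa> * \<bar>D n x\<bar>" "\<bar>D n x\<bar> \<le> exp \<kappa> * \<bar>D n \<xi>\<bar>"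
    by (simp_all add: exp_add exp_L)
qed

text \<open>Were the image shorter than 1, distortion would compare the mean value derivative with
  \<open>D n x\<close>, and the linearised length could not exceed
  \<open>exp \<kappa>\<close>.\<close>

lemma iterate_ge_1:
  assumes "\<bar>x - y\<bar> * \<bar>D n x\<bar> > exp \<kappa>"
  shows "\<bar>(F ^^ n) x - (F ^^ n) y\<bar> \<ge> 1"
proof (rule ccontr)
  assume "\<not> ?thesis"
  then have less: "\<bar>(F ^^ n) x - (F ^^ n) y\<bar> < 1" by simp
  obtain \<xi> where \<xi>: "min x y \<le> \<xi>" "\<xi> \<le> max x y"
    "\<bar>(F ^^ n) x - (F ^^ n) y\<bar> = \<bar>D n \<xi>\<bar> * \<bar>x - y\<bar>" by (rule MVT_iterate)
  have "\<bar>x - y\<bar> * \<bar>D n x\<bar> \<le> \<bar>x - y\<bar> * (exp \<kappa> * \<bar>D n \<xi>\<bar>)"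
    using D_between(2)[OF \<xi>(1,2)] less by (intro mult_left_mono) auto
  also have "\<dots> = exp \<kappa> * \<bar>(F ^^ n) x - (F ^^ n) y\<bar>" using \<xi>(3) by simp
  also have "\<dots> \<le> exp \<kappa>" using less by simp
  finally show False using assms by simp
qed

lemma iterate_le_1:
  assumes "\<bar>x - y\<bar> * \<bar>D n x\<bar> < exp (- \<kappa>)"
  shows "\<bar>(F ^^ n) x - (F ^^ n) y\<bar> \<le> 1"
proof (rule ccontr)
  assume "\<not> ?thesis"
  then have gt: "\<bar>(F ^^ n) x - (F ^^ n) y\<bar> > 1" by simp
  \<comment> \<open>The distortion bound is available up to distance 1, so the arc is first cut
    where its image has length exactly 1.\<close>
  have "\<exists>y'. min x y \<le> y' \<and> y' \<le> max x y \<and> \<bar>(F ^^ n) x - (F ^^ n) y'\<bar> = 1"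
  proof (cases "x \<le> y")
    case True
    have "\<exists>y'\<ge>x. y' \<le> y \<and> \<bar>(F ^^ n) x - (F ^^ n) y'\<bar> = 1"
      using gt True by (intro IVT') (auto intro!: continuous_intros continuous_iterate)
    then show ?thesis using True by (auto simp: min_def max_def)
  next
    case False
    have "\<exists>y'\<ge>y. y' \<le> x \<and> \<bar>(F ^^ n) x - (F ^^ n) y'\<bar> = 1"
      using gt False by (intro IVT2') (auto intro!: continuous_intros continuous_iterate)
    then show ?thesis using False by (auto simp: min_def max_def)
  qed
  then obtain y' where y': "min x y \<le> y'" "y' \<le> max x y" "\<bar>(F ^^ n) x - (F ^^ n) y'\<bar> = 1" by blast
  obtain \<xi> where \<xi>: "min x y' \<le> \<xi>" "\<xi> \<le> max x y'"
    "\<bar>(F ^^ n) x - (F ^^ n) y'\<bar> = \<bar>D n \<xi>\<bar> * \<bar>x - y'\<bar>" by (rule MVT_iterate)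
  have "1 = \<bar>D n \<xi>\<bar> * \<bar>x - y'\<bar>" using \<xi>(3) y'(3) by simp
  also have "\<dots> \<le> (exp \<kappa> * \<bar>D n x\<bar>) * \<bar>x - y\<bar>"
    using D_between(1)[OF \<xi>(1,2)] y' by (intro mult_mono) auto
  also have "\<dots> = exp \<kappa> * (\<bar>x - y\<bar> * \<bar>D n x\<bar>)" by simp
  also have "\<dots> < exp \<kappa> * exp (- \<kappa>)" using assms by simp
  finally show False by (simp add: exp_minus)
qed

section \<open>Counting separated points through the lift\<close>

lemma card_separated_le:
  assumes "\<epsilon> > 0" "m \<le> n"
    and near: "\<And>u. u \<in> {x - r..x + r} \<Longrightarrow> \<bar>(F ^^ m) x - (F ^^ m) u\<bar> \<le> 1"
    and A: "A \<subseteq> circle_of ` {x - r..x + r}" "separated f n \<epsilon> A"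
  shows "real (card A) \<le> \<bar>of_int d\<bar> ^ (n - m) * (2 / \<epsilon> + 1)"
proof -
  define M where "M = \<bar>real_of_int d\<bar> ^ (n - m)"
  have M: "1 \<le> M" using degree_gt_1 by (simp add: M_def one_le_power)
  \<comment> \<open>One representative in the interval is chosen for each point of \<open>A\<close>,
    so that counting \<open>U\<close> counts \<open>A\<close>.\<close>
  obtain U where U: "U \<subseteq> {x - r..x + r}" "inj_on circle_of U" "A = circle_of ` U"
    using A(1) by (meson subset_image_inj)
  have iter: "(F ^^ (n - m)) ((F ^^ m) u) = (F ^^ n) u" for u
    using \<open>m \<le> n\<close> by (metis comp_apply funpow_add le_add_diff_inverse2)
  \<comment> \<open>The image at time m stays within distance 1 of the centre and grows by at most
    the power of the degree in the remaining \<open>n - m\<close> steps.\<close>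
  have "(F ^^ n) ` U \<subseteq> {(F ^^ n) x - M..(F ^^ n) x + M}"
    using iterate_le_degree[OF near, of _ "n - m"] U(1)
    unfolding iter M_def[symmetric] by (fastforce simp: abs_le_iff)
  \<comment> \<open>Distances on the line dominate those on the circle and increase with time, so
    separation before time n forces separation on the line at time n.\<close>
  moreover have "\<bar>s - t\<bar> > \<epsilon>" if st: "s \<in> (F ^^ n) ` U" "t \<in> (F ^^ n) ` U" "s \<noteq> t" for s t
  proof -
    obtain u v where uv: "u \<in> U" "v \<in> U" "s = (F ^^ n) u" "t = (F ^^ n) v" using st by blast
    then have "circle_of u \<noteq> circle_of v" using U(2) st(3) by (auto dest: inj_onD)
    then obtain j where "j < n" "dist ((f ^^ j) (circle_of u)) ((f ^^ j) (circle_of v)) > \<epsilon>"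
      using A(2) uv U(3) unfolding separated_def by blast
    then show ?thesis
      using dist_circle_of_le[of "(F ^^ j) u" "(F ^^ j) v"] iterate_distance_mono[of j n u v] uv
      by (simp add: iterate_circle_of dist_real_def)
  qed
  ultimately have "real (card ((F ^^ n) ` U)) \<le> ((F ^^ n) x + M - ((F ^^ n) x - M)) / \<epsilon> + 1"
    using \<open>\<epsilon> > 0\<close> M by (intro card_spread_le(2)) auto
  also have "\<dots> \<le> M * (2 / \<epsilon> + 1)" using M by (simp add: algebra_simps)
  also have "card ((F ^^ n) ` U) = card A"
    using U(2,3) inj_on_subset[OF inj_iterate[of n] subset_UNIV] by (simp add: card_image)
  finally show ?thesis unfolding M_def .
qed

text \<open>Up to the first time at which the distance in the lift exceeds \<open>\<epsilon>\<close> it stays below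
  \<open>C * \<epsilon> \<le> 1 / 2\<close>, so it is a distance on the circle.\<close>

lemma lifted_separation:
  assumes "\<bar>u - v\<bar> \<le> 1 / 2" "\<epsilon> * C \<le> 1 / 2" "C * \<epsilon> < \<bar>(F ^^ n) u - (F ^^ n) v\<bar>" "n > 0" "\<epsilon> > 0"
  shows "\<exists>j<n. dist ((f ^^ j) (circle_of u)) ((f ^^ j) (circle_of v)) > \<epsilon>"
proof -
  define P where "P j \<longleftrightarrow> \<epsilon> < \<bar>(F ^^ j) u - (F ^^ j) v\<bar>" for j
  obtain k where k: "n = Suc k" using \<open>n > 0\<close> gr0_implies_Suc by blast
  have "C * \<epsilon> < C * \<bar>(F ^^ k) u - (F ^^ k) v\<bar>"
    using assms(3) step_le[of k u v] unfolding k by linarith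
  then have "P k" using C_gt_1 by (simp add: P_def)
  define j where "j = (LEAST j. P j)"
  have j: "P j" "j \<le> k" using \<open>P k\<close> unfolding j_def by (auto intro: LeastI Least_le)
  have "\<bar>(F ^^ j) u - (F ^^ j) v\<bar> \<le> 1 / 2"
  proof (cases j)
    case 0
    then show ?thesis using assms(1) by simp
  next
    case (Suc i)
    then have "\<not> P i" unfolding j_def using not_less_Least by (metis lessI)
    then have "C * \<bar>(F ^^ i) u - (F ^^ i) v\<bar> \<le> C * \<epsilon>"
      using C_gt_1 by (intro mult_left_mono) (auto simp: P_def)
    then show ?thesis using step_le[of i u v] assms(2) Suc by (simp add: mult.commute)
  qed
  then show ?thesis
    using j k dist_circle_of_eq by (auto simp: iterate_circle_of P_def intro!: exI[of _ j])
qed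

text \<open>Equally spaced points of the image interval at time n are pulled back by the
  intermediate value theorem; their spacing is wide enough for
  \<open>lifted_separation\<close>.\<close>

lemma separated_set_exists:
  assumes "\<epsilon> > 0" "\<epsilon> * C \<le> 1 / 2" "m \<le> n" "n > 0" "0 \<le> r" "r \<le> 1 / 2"
    and far: "\<bar>(F ^^ m) x - (F ^^ m) (x + r)\<bar> \<ge> 1"
  obtains A where "finite A" "A \<subseteq> circle_of ` {x..x + r}" "separated f n \<epsilon> A"
    "\<bar>of_int d\<bar> ^ (n - m) / (2 * C * \<epsilon>) \<le> real (card A)"
proof -
  \<comment> \<open>Twice the threshold \<open>C * \<epsilon>\<close> of
    \<open>lifted_separation\<close>, whose inequality is strict.\<close>
  define \<delta> where "\<delta> = 2 * C * \<epsilon>"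
  have \<delta>: "\<delta> > 0" using assms(1) C_gt_1 by (simp add: \<delta>_def)
  \<comment> \<open>The sign records whether \<open>F ^^ n\<close> preserves orientation.\<close>
  define \<sigma> :: real where "\<sigma> = sgn ((F ^^ n) (x + r) - (F ^^ n) x)"
  define l where "l = \<bar>(F ^^ n) x - (F ^^ n) (x + r)\<bar>"
  define N where "N = nat \<lfloor>l / \<delta>\<rfloor>"
  have iter: "(F ^^ (n - m)) ((F ^^ m) u) = (F ^^ n) u" for u
    using \<open>m \<le> n\<close> by (metis comp_apply funpow_add le_add_diff_inverse2)
  have l: "\<bar>of_int d\<bar> ^ (n - m) \<le> l"
    using iterate_ge_degree[OF far, of "n - m"] unfolding iter l_def .
  moreover have "0 < \<bar>real_of_int d\<bar> ^ (n - m)"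
    using degree_gt_1 by (intro zero_less_power) linarith
  ultimately have "l > 0" by linarith
  then have \<sigma>: "\<bar>\<sigma>\<bar> = 1" and end_eq: "(F ^^ n) (x + r) = (F ^^ n) x + \<sigma> * l"
    by (auto simp: \<sigma>_def l_def sgn_if)
  have "\<exists>u. u \<in> {x..x + r} \<and> (F ^^ n) u = (F ^^ n) x + \<sigma> * (\<delta> * real i)" if "i \<le> N" for i
  proof -
    have "real i \<le> l / \<delta>" using that \<open>l > 0\<close> \<delta> unfolding N_def
      by (metis divide_nonneg_pos le_nat_floor less_imp_le of_nat_floor of_nat_mono order_trans)
    then have "\<delta> * real i \<le> l" using \<delta> by (simp add: field_simps)
    moreover have "0 \<le> \<delta> * real i" using \<delta> by simp
    moreover have "\<sigma> = 1 \<or> \<sigma> = - 1" using \<sigma> by linarith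
    ultimately have "\<exists>u\<ge>x. u \<le> x + r \<and> (F ^^ n) u = (F ^^ n) x + \<sigma> * (\<delta> * real i)"
      using assms(5) end_eq continuous_iterate
        IVT'[of "F ^^ n" x "(F ^^ n) x + \<delta> * real i" "x + r"]
        IVT2'[of "F ^^ n" "x + r" "(F ^^ n) x - \<delta> * real i" x]
      by auto
    then show ?thesis by auto
  qed
  then obtain p where p: "\<And>i. i \<le> N \<Longrightarrow> p i \<in> {x..x + r}"
    "\<And>i. i \<le> N \<Longrightarrow> (F ^^ n) (p i) = (F ^^ n) x + \<sigma> * (\<delta> * real i)" by metis
  have sep: "\<exists>j<n. dist ((f ^^ j) (circle_of (p i))) ((f ^^ j) (circle_of (p k))) > \<epsilon>"
    if ik: "i \<le> N" "k \<le> N" "i \<noteq> k" for i k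
  proof (rule lifted_separation)
    show "\<bar>p i - p k\<bar> \<le> 1 / 2" using p(1)[OF ik(1)] p(1)[OF ik(2)] assms(6) unfolding atLeastAtMost_iff by linarith
    have "(F ^^ n) (p i) - (F ^^ n) (p k) = \<sigma> * \<delta> * (real i - real k)"
      using p(2) ik by (simp add: algebra_simps)
    then have "\<bar>(F ^^ n) (p i) - (F ^^ n) (p k)\<bar> = \<delta> * \<bar>real i - real k\<bar>"
      using \<sigma> \<delta> by (simp add: abs_mult)
    moreover have "1 \<le> \<bar>real i - real k\<bar>" using ik(3) by linarith
    then have "\<delta> * 1 \<le> \<delta> * \<bar>real i - real k\<bar>" using \<delta> by (intro mult_left_mono) auto
    moreover have "C * \<epsilon> < \<delta>" using assms(1) C_gt_1 by (simp add: \<delta>_def)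
    ultimately show "C * \<epsilon> < \<bar>(F ^^ n) (p i) - (F ^^ n) (p k)\<bar>" by linarith
  qed (use assms in auto)
  define A where "A = (\<lambda>i. circle_of (p i)) ` {..N}"
  have "inj_on (\<lambda>i. circle_of (p i)) {..N}"
  proof (rule inj_onI)
    fix i k assume "i \<in> {..N}" "k \<in> {..N}" "circle_of (p i) = circle_of (p k)"
    then show "i = k" using sep[of i k] assms(1) by fastforce
  qed
  then have "card A = N + 1" by (simp add: A_def card_image)
  \<comment> \<open>Using both end indices, 0 and \<open>N\<close>, compensates the rounding down in
    \<open>N\<close>.\<close>
  moreover have "l / \<delta> \<le> real N + 1"
    unfolding N_def by linarith
  moreover have "\<bar>of_int d\<bar> ^ (n - m) / \<delta> \<le> l / \<delta>"
    using l \<delta> by (simp add: divide_right_mono)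
  ultimately have "\<bar>of_int d\<bar> ^ (n - m) / (2 * C * \<epsilon>) \<le> real (card A)"
    unfolding \<delta>_def by simp
  moreover have "finite A" "A \<subseteq> circle_of ` {x..x + r}" using p(1) by (auto simp: A_def)
  moreover have "separated f n \<epsilon> A"
    unfolding separated_def A_def using sep by fastforce
  ultimately show thesis using that by blast
qed

section \<open>Growth rates at a point\<close>

lemma L_1_ge: "ln c \<le> L 1 x"
  using c_gt_1 c_le[of x] by (simp add: L_def D_def)

lemma L_mono: "mono (\<lambda>n. L n x)"
proof (rule incseq_SucI)
  fix n
  have "0 < ln c" using c_gt_1 by simp
  then show "L n x \<le> L (Suc n) x" unfolding L_Suc[of n] using L_1_ge[of "(F ^^ n) x"] by linarith
qed

lemma L_ge: "real n * ln c \<le> L n x"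
proof -
  have "ln (c ^ n) \<le> L n x"
    unfolding L_def using D_ge c_gt_1 D_pos by (subst ln_le_cancel_iff) auto
  then show ?thesis using c_gt_1 by (simp add: ln_realpow)
qed

lemma L_le: "L n x \<le> real n * ln C"
proof -
  have "L n x \<le> ln (C ^ n)"
    unfolding L_def using D_le C_gt_1 D_pos by (subst ln_le_cancel_iff) auto
  then show ?thesis using C_gt_1 by (simp add: ln_realpow)
qed

lemma L_at_top: "filterlim (\<lambda>n. L n x) at_top sequentially"
proof (rule filterlim_at_top_mono)
  show "filterlim (\<lambda>n. ln c * real n) at_top sequentially"
    using c_gt_1 by (intro filterlim_tendsto_pos_mult_at_top[OF tendsto_const] filterlim_real_sequentially) auto
qed (simp add: L_ge mult.commute)

definition h :: real where "h = ln \<bar>of_int d\<bar>"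

lemma h_pos: "0 < h"
  using degree_gt_1 by (simp add: h_def)

text \<open>The dynamical input to the comparison of growth rates. The constant \<open>K\<close> is
  chosen after \<open>\<epsilon>\<close>, but the limits derived from it do not depend on
  \<open>\<epsilon>\<close>.\<close>

lemma separation_rates:
  assumes "0 < \<epsilon>" "\<epsilon> * C \<le> 1 / 2" "0 \<le> \<omega>"
  shows "\<exists>K. growth_rates (\<lambda>m. L m x)
    (\<lambda>n. 1 / real n * ln (real (max_separated f n \<epsilon>
       (closure (ball (circle_of x) (exp (- \<omega> * real n))))))) \<omega> h K"
proof -
  define A where "A = 2 / \<epsilon> + 1"
  define E where "E = 2 * C * \<epsilon>"
  \<comment> \<open>\<open>\<kappa>\<close> pays for distortion, \<open>ln 8\<close> for strictness
    and for the smaller arc used in the lower bound, and the last two terms for the constant factors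
    in the two counts.\<close>
  define K where "K = \<kappa> + ln 8 + ln A + \<bar>ln E\<bar>"
  define r where "r n = exp (- \<omega> * real n)" for n
  define N where "N n = real (max_separated f n \<epsilon> (closure (ball (circle_of x) (r n))))" for n
  have "1 \<le> A" "0 < E" using assms(1) C_gt_1 by (auto simp: A_def E_def)
  then have "0 \<le> ln A" by simp
  moreover have "0 < ln (8::real)" by simp
  ultimately have K: "\<kappa> < K" "\<kappa> + ln 8 \<le> K" "ln A \<le> K" "ln E \<le> K" "0 \<le> K"
    using \<kappa>_nonneg unfolding K_def by linarith+
  have r: "0 < r n" "r n \<le> 1" for n using assms(3) by (auto simp: r_def)
  have d: "0 < \<bar>real_of_int d\<bar> ^ k" "ln (\<bar>real_of_int d\<bar> ^ k) = real k * h" for k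
    using degree_gt_1 zero_less_power[of "\<bar>real_of_int d\<bar>" k] by (auto simp: h_def ln_realpow)
  have D_r: "r n * \<bar>D m x\<bar> = exp (L m x - \<omega> * real n)" for m n
    by (simp add: r_def exp_L[symmetric] exp_diff exp_minus field_simps)
  have card_le: "real (card X) \<le> \<bar>of_int d\<bar> ^ (n - m) * A"
    if "m \<le> n" "m = 0 \<or> L m x \<le> \<omega> * real n - K"
      "X \<subseteq> closure (ball (circle_of x) (r n))" "separated f n \<epsilon> X" for X m n
    unfolding A_def
  proof (rule card_separated_le[OF assms(1) that(1)])
    show "X \<subseteq> circle_of ` {x - r n..x + r n}"
      using that(3) closure_ball_circle_subset by blast
    fix u assume "u \<in> {x - r n..x + r n}"
    then have u: "\<bar>x - u\<bar> \<le> r n" by auto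
    show "\<bar>(F ^^ m) x - (F ^^ m) u\<bar> \<le> 1"
    proof (cases "m = 0")
      case True
      then show ?thesis using u r(2)[of n] by simp
    next
      case False
      have "\<bar>x - u\<bar> * \<bar>D m x\<bar> \<le> r n * \<bar>D m x\<bar>" using u by (simp add: mult_right_mono)
      also have "\<dots> < exp (- \<kappa>)" unfolding D_r using that(2) False K(1) by simp
      finally show ?thesis by (rule iterate_le_1)
    qed
  qed (rule that(4))
  show ?thesis
    unfolding r_def[symmetric] N_def[symmetric]
  proof (intro exI[of _ K] growth_rates.intro)
    fix n m :: nat
    \<comment> \<open>The count is a natural number, and the value 0 is harmless because
      \<open>ln 0 = 0\<close> by convention.\<close>
    show "0 \<le> 1 / real n * ln (N n)"
      by (cases "N n = 0") (simp_all add: N_def)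
    assume n: "0 < n" "m \<le> n"
    have *: "real n * (1 / real n * ln (N n)) = ln (N n)" using n by simp
    show "real n * (1 / real n * ln (N n)) \<le> K + real (n - m) * h"
      if m: "m = 0 \<or> L m x \<le> \<omega> * real n - K"
    proof (cases "N n = 0")
      case True
      then show ?thesis using K(5) h_pos by simp
    next
      case False
      then have "0 < N n" by (simp add: N_def)
      moreover have "N n \<le> \<bar>of_int d\<bar> ^ (n - m) * A"
        unfolding N_def using card_le[OF n(2) m] by (intro max_separated_le)
      ultimately have "ln (N n) \<le> ln (\<bar>of_int d\<bar> ^ (n - m) * A)" by simp
      also have "\<dots> = real (n - m) * h + ln A"
        using d[of "n - m"] \<open>1 \<le> A\<close> by (subst ln_mult) auto
      finally show ?thesis unfolding * using K(3) by linarith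
    qed
    show "real (n - m) * h - K \<le> real n * (1 / real n * ln (N n))"
      if m: "\<omega> * real n + K \<le> L m x"
    proof -
      \<comment> \<open>A quarter of the radius keeps the arc inside the open ball and below length
        1/2. The factor 8 then leaves \<open>2 * exp \<kappa>\<close>, strictly above the threshold
        of \<open>iterate_ge_1\<close>.\<close>
      have "8 * exp \<kappa> = exp (\<kappa> + ln 8)" by (simp add: exp_add)
      also have "\<dots> \<le> r n * \<bar>D m x\<bar>" unfolding D_r using m K(2) by simp
      finally have "8 * exp \<kappa> \<le> r n * \<bar>D m x\<bar>" .
      then have "exp \<kappa> < r n / 4 * \<bar>D m x\<bar>" using exp_gt_zero[of \<kappa>] by linarith
      then have "\<bar>(F ^^ m) x - (F ^^ m) (x + r n / 4)\<bar> \<ge> 1"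
        using r(1)[of n] by (intro iterate_ge_1) auto
      then obtain X where X: "finite X" "X \<subseteq> circle_of ` {x..x + r n / 4}" "separated f n \<epsilon> X"
        "\<bar>of_int d\<bar> ^ (n - m) / (2 * C * \<epsilon>) \<le> real (card X)"
        using separated_set_exists[OF assms(1,2) n(2,1), of "r n / 4" x] r[of n] by auto
      have "circle_of ` {x..x + r n / 4} \<subseteq> ball (circle_of x) (r n)"
        using r[of n] by (auto simp: dist_real_def intro!: le_less_trans[OF dist_circle_of_le])
      then have "X \<subseteq> closure (ball (circle_of x) (r n))" using X(2) closure_subset by blast
      \<comment> \<open>The upper count at time 0 supplies the a priori bound that makes the maximum
        meaningful.\<close>
      then have "card X \<le> max_separated f n \<epsilon> (closure (ball (circle_of x) (r n)))"
        using X card_le[of 0 n] by (intro card_le_max_separated) auto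
      then have "\<bar>of_int d\<bar> ^ (n - m) / E \<le> N n" using X(4) unfolding N_def E_def by linarith
      moreover have "0 < \<bar>of_int d\<bar> ^ (n - m) / E" using d(1) \<open>0 < E\<close> by (rule divide_pos_pos)
      ultimately have "ln (\<bar>of_int d\<bar> ^ (n - m) / E) \<le> ln (N n)" by simp
      also have "ln (\<bar>of_int d\<bar> ^ (n - m) / E) = real (n - m) * h - ln E"
        using d[of "n - m"] \<open>0 < E\<close> by (subst ln_div) auto
      finally show ?thesis unfolding * using K(4) by linarith
    qed
  qed (use assms(3) h_pos K(5) L_mono L_at_top in auto)
qed

section \<open>Entropies in terms of degree and Lyapunov exponents\<close>

lemma eventually_admissible: "\<forall>\<^sub>F \<epsilon> in at_right 0. 0 < \<epsilon> \<and> \<epsilon> * C \<le> 1 / 2"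
proof -
  have "\<forall>\<^sub>F \<epsilon> in at_right 0. \<epsilon> \<in> {0<..<1 / (2 * C)}"
    using C_gt_1 by (intro eventually_at_right_real) simp
  then show ?thesis
    by eventually_elim (use C_gt_1 in \<open>auto simp: field_simps\<close>)
qed

lemma lyapunov_sequence:
  "ereal (1 / real n * ln \<bar>circle_deriv (f ^^ n) (circle_of x)\<bar>) = ereal (1 / real n * L n x)"
  by (simp add: circle_deriv_iterate L_def)

text \<open>The exponents lie between \<open>ln c\<close> and \<open>ln C\<close>. Being positive
  reals, they can serve as denominators in real arithmetic.\<close>

lemma lyapunov_finite:
  obtains l l' where "lower_lyapunov f (circle_of x) = ereal l" "0 < l"
    "upper_lyapunov f (circle_of x) = ereal l'" "0 < l'"
proof -
  have "\<forall>\<^sub>F n in sequentially. ereal (ln c) \<le> ereal (1 / real n * L n x)"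
    using eventually_gt_at_top[of 0]
    by eventually_elim (use L_ge in \<open>simp add: field_simps\<close>)
  then have "ereal (ln c) \<le> lower_lyapunov f (circle_of x)"
    unfolding lower_lyapunov_def lyapunov_sequence by (rule Liminf_bounded)
  moreover have "\<forall>\<^sub>F n in sequentially. ereal (1 / real n * L n x) \<le> ereal (ln C)"
    using eventually_gt_at_top[of 0]
    by eventually_elim (use L_le in \<open>simp add: field_simps\<close>)
  then have "upper_lyapunov f (circle_of x) \<le> ereal (ln C)"
    unfolding upper_lyapunov_def lyapunov_sequence by (rule Limsup_bounded)
  moreover have "lower_lyapunov f (circle_of x) \<le> upper_lyapunov f (circle_of x)"
    unfolding lower_lyapunov_def upper_lyapunov_def by (rule Liminf_le_Limsup) simp
  moreover have "0 < ln c" using c_gt_1 by simp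
  ultimately show thesis
    using that by (cases "lower_lyapunov f (circle_of x)"; cases "upper_lyapunov f (circle_of x)") auto
qed

text \<open>For every admissible \<open>\<epsilon>\<close> the limsup already has the same value, so
  the limit as \<open>\<epsilon>\<close> tends to 0 is that of an eventually constant
  function.\<close>

lemma upper_translocal_entropy_eq:
  assumes "0 \<le> \<omega>" "upper_lyapunov f (circle_of x) = ereal l" "0 < l"
  shows "upper_translocal_entropy f \<omega> (circle_of x) = ereal (max 0 ((1 - \<omega> / l) * h))"
  unfolding upper_translocal_entropy_def
proof (intro tendsto_Lim tendsto_eventually eventually_mono[OF eventually_admissible])
  fix \<epsilon> assume "0 < \<epsilon> \<and> \<epsilon> * C \<le> 1 / 2"
  then obtain K where "growth_rates (\<lambda>m. L m x) (\<lambda>n. 1 / real n * ln (real (max_separated f n \<epsilon>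
       (closure (ball (circle_of x) (exp (- \<omega> * real n))))))) \<omega> h K"
    using separation_rates assms(1) by blast
  from growth_rates.limsup_eq_g[OF this _ assms(3)] assms(2)
  show "limsup (\<lambda>n. ereal (1 / real n * ln (real (max_separated f n \<epsilon>
       (closure (ball (circle_of x) (exp (- \<omega> * real n)))))))) = ereal (max 0 ((1 - \<omega> / l) * h))"
    unfolding upper_lyapunov_def lyapunov_sequence growth_rates.g_def[OF \<open>growth_rates _ _ _ _ _\<close>] .
qed simp

lemma lower_translocal_entropy_eq:
  assumes "0 \<le> \<omega>" "lower_lyapunov f (circle_of x) = ereal l" "0 < l"
  shows "lower_translocal_entropy f \<omega> (circle_of x) = ereal (max 0 ((1 - \<omega> / l) * h))"
  unfolding lower_translocal_entropy_def
proof (intro tendsto_Lim tendsto_eventually eventually_mono[OF eventually_admissible])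
  fix \<epsilon> assume "0 < \<epsilon> \<and> \<epsilon> * C \<le> 1 / 2"
  then obtain K where "growth_rates (\<lambda>m. L m x) (\<lambda>n. 1 / real n * ln (real (max_separated f n \<epsilon>
       (closure (ball (circle_of x) (exp (- \<omega> * real n))))))) \<omega> h K"
    using separation_rates assms(1) by blast
  from growth_rates.liminf_eq_g[OF this _ assms(3)] assms(2)
  show "liminf (\<lambda>n. ereal (1 / real n * ln (real (max_separated f n \<epsilon>
       (closure (ball (circle_of x) (exp (- \<omega> * real n)))))))) = ereal (max 0 ((1 - \<omega> / l) * h))"
    unfolding lower_lyapunov_def lyapunov_sequence growth_rates.g_def[OF \<open>growth_rates _ _ _ _ _\<close>] .
qed simp

text \<open>For \<omega> = 0 the ball has constant radius 1, more than the diameter of the circle,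
  and the exponent drops out of the formula.\<close>

lemma h_top_eq: "h_top f = ereal h"
proof -
  have "w \<in> ball (circle_of 0) 1" for w
  proof -
    obtain y where "w = circle_of y" by (rule circle_of_cases)
    then show ?thesis
      using of_int_round_abs_le[of "0 - y"] unfolding mem_ball by (simp only: dist_circle_of)
  qed
  then have "ball (circle_of 0) 1 = UNIV" by blast
  then have "h_top f = upper_translocal_entropy f 0 (circle_of 0)"
    by (simp add: h_top_def upper_translocal_entropy_def)
  moreover obtain l where "upper_lyapunov f (circle_of 0) = ereal l" "0 < l"
    by (rule lyapunov_finite)
  ultimately show ?thesis using upper_translocal_entropy_eq[of 0 0 l] h_pos by simp
qed

end

section \<open>Constants of an expanding map\<close>

lemma expanding_lift_exists:
  assumes "circle_C2 f" "expanding f"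
  obtains F F' c C B d where "expanding_lift f F F' c C B d"
proof -
  obtain F F' F'' where F: "circle_lift f F"
    "\<And>x. (F has_real_derivative F' x) (at x)" "\<And>x. (F' has_real_derivative F'' x) (at x)"
    "continuous_on UNIV F''"
    using assms(1) unfolding circle_C2_def by blast
  obtain c where c: "1 < c" "\<And>z. c \<le> \<bar>circle_deriv f z\<bar>"
    using assms(2) unfolding expanding_def by blast
  obtain m where m: "\<And>x. F (x + 1) = F x + m"
    using circle_lift_diff_const[OF F(1) F(1), of 1] by auto
  \<comment> \<open>The reals 0 and 1 represent the same point, so the translation constant
    \<open>m\<close> is an integer, the degree.\<close>
  have "circle_of (F (0 + 1)) = circle_of (F 0)"
    using F(1) unfolding circle_lift_def by (metis Ints_1 add_0 circle_of_eq_iff diff_zero)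
  then have "m \<in> \<int>" by (simp add: m circle_of_eq_iff del: add_0)
  then obtain d :: int where d: "m = of_int d" by (elim Ints_cases)
  \<comment> \<open>Differentiating the translation relation makes both derivatives periodic, hence
    bounded by compactness of a period.\<close>
  have per': "F' (x + 1) = F' x" for x
  proof (rule DERIV_unique)
    show "((\<lambda>t. F t + m) has_real_derivative F' (x + 1)) (at x)"
      using F(2)[of "x + 1"] DERIV_shift[of F _ x 1] m by simp
    show "((\<lambda>t. F t + m) has_real_derivative F' x) (at x)"
      using F(2)[of x] by (auto intro!: derivative_eq_intros)
  qed
  have per'': "F'' (x + 1) = F'' x" for x
  proof (rule DERIV_unique)
    show "(F' has_real_derivative F'' (x + 1)) (at x)"
      using F(3)[of "x + 1"] DERIV_shift[of F' _ x 1] per' by simp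
  qed (rule F(3))
  have "continuous_on UNIV F'"
    using F(3) DERIV_isCont continuous_at_imp_continuous_on by blast
  then obtain C where C: "\<And>x. \<bar>F' x\<bar> \<le> C"
    using periodic_continuous_bounded per' by blast
  obtain B where B: "\<And>x. \<bar>F'' x\<bar> \<le> B"
    using periodic_continuous_bounded[OF F(4) per''] by blast
  have "expanding_lift f F F' c C B d"
  proof
    show "c \<le> \<bar>F' x\<bar>" for x using c(2)[of "circle_of x"] circle_deriv_eq[OF F(1,2)] by simp
    show "\<bar>F' x - F' y\<bar> \<le> B * \<bar>x - y\<bar>" for x y
      using field_differentiable_bound[of UNIV F' F'' B x y] F(3) B by simp
  qed (use F c C m d in auto)
  then show thesis by (rule that)
qed

theorem theorem2p1:
  fixes f :: "circle \<Rightarrow> circle" and \<omega> :: real and z :: circle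
  assumes "circle_C2 f" and "expanding f" and "\<omega> \<ge> 0"
  shows "upper_translocal_entropy f \<omega> z
           = max ((1 - ereal \<omega> / upper_lyapunov f z) * h_top f) 0
       \<and> lower_translocal_entropy f \<omega> z
           = max ((1 - ereal \<omega> / lower_lyapunov f z) * h_top f) 0"
proof -
  obtain F F' c C B d where "expanding_lift f F F' c C B d"
    using assms(1,2) by (rule expanding_lift_exists)
  then interpret expanding_lift f F F' c C B d .
  obtain x where x: "z = circle_of x" by (rule circle_of_cases)
  obtain l l' where l: "lower_lyapunov f z = ereal l" "0 < l"
    "upper_lyapunov f z = ereal l'" "0 < l'"
    unfolding x by (rule lyapunov_finite)
  \<comment> \<open>For a positive real exponent the extended real expression agrees with the real
    one.\<close>
  have *: "ereal (max 0 ((1 - \<omega> / t) * h)) = max ((1 - ereal \<omega> / ereal t) * ereal h) 0" if "0 < t" for t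
    using that by (simp add: one_ereal_def zero_ereal_def max.commute)
  show ?thesis
    using upper_translocal_entropy_eq[OF assms(3), of x l'] lower_translocal_entropy_eq[OF assms(3), of x l] l
    by (simp only: x h_top_eq *)
qed

end
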